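(* For every $x_0\in\mathbb{N}_0$, the orbit $(x_n)_{n\ge 0}$ of the recursion $x_{n+1}=S(x_n)$ either reaches zero (that is, $x_n=0$ for some $n\ge 0$) or is unbounded, i.e. escapes to infinity.
   Context: Let $\mathbb{N}_0=\{0,1,2,\ldots\}$. The map $S:\mathbb{N}_0\to\mathbb{N}_0$ is defined by $S(n)=n/2$ if $n$ is even and $S(n)=\frac{n^2-1}{4}$ if $n$ is odd. For $x_0\in\mathbb{N}_0$, the orbit of $x_0$ is the sequence $(x_n)_{n\ge 0}$ with $x_{n+1}=S(x_n)$. The phrase "escapes to infinity" is used as a synonym for the orbit being unbounded, i.e. $\sup_n x_n=\infty$. *)

theory Defs
  imports Main
begin

(* The truncating operations on nat are harmless here: an odd n satisfies n \<ge> 1 and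
   4 dvd n^2 - 1 (see S_odd_exact). *)
definition S :: "nat \<Rightarrow> nat" where
  "S n = (if even n then n div 2 else (n\<^sup>2 - 1) div 4)"

lemma S_odd_exact:
  assumes "odd n"
  shows "4 * int (S n) = (int n)\<^sup>2 - 1"
proof -
  from assms obtain m where m: "n = 2 * m + 1" by (rule oddE)
  have "n\<^sup>2 - 1 = 4 * (m * (m + 1))"
    by (simp add: m power2_eq_square algebra_simps)
  then have "S n = m * (m + 1)"
    using assms by (simp add: S_def)
  then show ?thesis
    by (simp add: m power2_eq_square algebra_simps)
qed

end

(* S sends 2 m + 1 to m (m + 1), and one of m, m + 1 is even, say equal to 2^b c with c odd.
   Halving b times leads to an odd number, c times the other factor. If c > 1 it exceeds 2 m + 1.
   If c = 1, then 2 m + 1 = 2^(b+1) + 1 or 2^(b+1) - 1, and the odd number reached has the same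
   shape with b in place of b + 1, so the orbit descends to 0. Thus an orbit that avoids 0 contains
   larger and larger odd numbers. *)
theory Submission
  imports Defs
begin

lemma S_double [simp]: "S (2 * m) = m"
  by (simp add: S_def)

lemma S_odd: "S (2 * m + 1) = m * (m + 1)"
  using S_odd_exact[of "2 * m + 1"]
  by (simp add: power2_eq_square algebra_simps flip: of_nat_mult of_nat_add)

lemma exists_odd_part:
  fixes n :: nat
  assumes "n > 0"
  obtains b c where "n = 2 ^ b * c" "odd c"
proof -
  from assms have "\<exists>b c. n = 2 ^ b * c \<and> odd c"
  proof (induction n rule: less_induct)
    case (less n)
    show ?case
    proof (cases "odd n")
      case True
      then show ?thesis by (intro exI[of _ 0] exI[of _ n]) simp
    next
      case False
      then obtain m where m: "n = 2 * m" by (auto elim: evenE)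
      with less.prems less.IH[of m] obtain b c where "m = 2 ^ b * c" "odd c" by auto
      then show ?thesis using m by (intro exI[of _ "Suc b"] exI[of _ c]) simp
    qed
  qed
  then show thesis using that by blast
qed

context
  fixes x :: "nat \<Rightarrow> nat"
  assumes step: "\<And>n. x (Suc n) = S (x n)"
begin

lemma orbit_halving: "x i = 2 ^ b * c \<Longrightarrow> x (i + b) = c"
proof (induction b arbitrary: i)
  case (Suc b)
  then have "x (Suc i) = 2 ^ b * c" by (simp add: step mult.assoc)
  from Suc.IH[OF this] show ?case by simp
qed simp

text \<open>Halving \<open>b\<close> times needs only the factor \<open>2 ^ b\<close>, so
  \<open>c\<close> may be even; \<open>c = 2\<close> does occur below.\<close>

lemma orbit_odd:
  assumes "x i = 2 * m + 1" "m * (m + 1) = 2 ^ b * c"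
  shows "x (Suc i + b) = c"
  by (rule orbit_halving) (use assms in \<open>simp only: step S_odd\<close>)

text \<open>For \<open>m = 2 ^ b\<close> the product \<open>m * (m + 1)\<close> is
  \<open>2 ^ b * (2 ^ b + 1)\<close>, so the exponent drops by one.\<close>

lemma orbit_power_plus_one_reaches_zero: "x i = 2 ^ b + 1 \<Longrightarrow> \<exists>n. x n = 0"
proof (induction b arbitrary: i)
  case 0
  \<comment> \<open>Exponent 0 gives the even value 2, and the orbit runs 2, 1, 0.\<close>
  then have "x (Suc i) = 1" by (simp add: step S_def)
  then have "x (Suc (Suc i)) = 0" by (simp add: step S_def)
  then show ?case ..
next
  case (Suc b)
  then have "x (Suc i + b) = 2 ^ b + 1" by (intro orbit_odd[of _ "2 ^ b"]) simp_all
  then show ?case by (rule Suc.IH)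
qed

text \<open>Now \<open>m = 2 ^ b - 1\<close>, and the power of two comes from \<open>m + 1\<close>.
  The descent ends at \<open>2 ^ 0 - 1 = 0\<close>.\<close>

lemma orbit_power_minus_one_reaches_zero: "x i = 2 ^ b - 1 \<Longrightarrow> \<exists>n. x n = 0"
proof (induction b arbitrary: i)
  case 0
  then show ?case by auto
next
  case (Suc b)
  have pos: "(2::nat) ^ b \<ge> 1" by simp
  with Suc.prems have "x i = 2 * (2 ^ b - 1) + 1" unfolding power_Suc by linarith
  then have "x (Suc i + b) = 2 ^ b - 1"
    by (rule orbit_odd) (use pos in simp)
  then show ?case by (rule Suc.IH)
qed

lemma orbit_odd_increases:
  assumes nz: "\<And>n. x n \<noteq> 0" and "odd (x i)"
  shows "\<exists>j. odd (x j) \<and> x j > x i"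
proof -
  from \<open>odd (x i)\<close> obtain m where m: "x i = 2 * m + 1" by (rule oddE)
  have ge3: "c \<ge> 3" if "odd c" "c \<noteq> 1" for c :: nat
    using that by (cases c; cases "c = 2") auto
  show ?thesis
  proof (cases "even m")
    case True
    \<comment> \<open>For \<open>m = 0\<close> the orbit would be at
      \<open>1 = 2 ^ 1 - 1\<close>.\<close>
    have "m > 0"
      using orbit_power_minus_one_reaches_zero[of i 1] nz m by (cases m) auto
    then obtain b c where bc: "m = 2 ^ b * c" "odd c" by (rule exists_odd_part)
    have "c \<noteq> 1"
      using orbit_power_plus_one_reaches_zero[of i "Suc b"] nz m bc by auto
    with bc have "c \<ge> 3" by (intro ge3)
    then have "c * (m + 1) \<ge> 3 * (m + 1)" by (rule mult_le_mono1)
    moreover have "x (Suc i + b) = c * (m + 1)"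
      by (rule orbit_odd[OF m]) (simp only: bc(1) mult.assoc)
    \<comment> \<open>The value \<open>c * (m + 1)\<close> is a product of odd factors and is at
      least \<open>3 * (m + 1) > 2 * m + 1\<close>.\<close>
    ultimately show ?thesis using m bc True by (intro exI[of _ "Suc i + b"]) simp
  next
    case False
    obtain b c where bc: "m + 1 = 2 ^ b * c" "odd c" using exists_odd_part[of "m + 1"] by auto
    have "c \<noteq> 1"
    proof
      assume "c = 1"
      with m bc have "x i = 2 ^ Suc b - 1" by simp
      then show False using orbit_power_minus_one_reaches_zero nz by blast
    qed
    with bc have c: "c \<ge> 3" by (intro ge3)
    then have "c * m \<ge> 3 * m" by (rule mult_le_mono1)
    \<comment> \<open>With \<open>c \<ge> 3\<close> this forces \<open>m \<ge> 2\<close>, which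
      makes \<open>3 * m > 2 * m + 1\<close> strict; at \<open>m = 1\<close> both sides are
      3.\<close>
    moreover have "c \<le> m + 1" unfolding bc(1) by simp
    ultimately have "c * m > 2 * m + 1" using c by linarith
    moreover have "x (Suc i + b) = c * m"
      by (rule orbit_odd[OF m]) (use bc in \<open>simp only: mult.commute mult.left_commute\<close>)
    ultimately show ?thesis using m bc(2) False by (intro exI[of _ "Suc i + b"]) simp
  qed
qed

text \<open>A strict increase in the naturals is at least one, so induction on \<open>N\<close>
  applies, starting from the odd part of the nonzero \<open>x 0\<close>.\<close>

lemma orbit_odd_unbounded:
  assumes nz: "\<And>n. x n \<noteq> 0"
  shows "\<exists>j. odd (x j) \<and> x j \<ge> N"
proof (induction N)
  case 0
  obtain b c where "x 0 = 2 ^ b * c" "odd c" using exists_odd_part[of "x 0"] nz by auto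
  then have "x (0 + b) = c" by (intro orbit_halving)
  with \<open>odd c\<close> show ?case by auto
next
  case (Suc N)
  then obtain j where "odd (x j)" "x j \<ge> N" by blast
  with orbit_odd_increases[OF nz, of j] show ?case by (metis Suc_leI le_less_trans)
qed

end

theorem theorem7:
  fixes x :: "nat \<Rightarrow> nat"
  assumes "\<And>n. x (Suc n) = S (x n)"
  shows "(\<exists>n. x n = 0) \<or> \<not> bdd_above (range x)"
proof (rule disjCI)
  assume "\<not> \<not> bdd_above (range x)"
  then obtain M where M: "\<And>n. x n \<le> M" by (auto simp: bdd_above_def)
  show "\<exists>n. x n = 0"
  proof (rule ccontr)
    assume "\<nexists>n. x n = 0"
    then obtain j where "x j \<ge> Suc M" using orbit_odd_unbounded[of x, OF assms, of "Suc M"] by auto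
    with M[of j] show False by simp
  qed
qed

end
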